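(* Consider the system model described in the context, with marginal SINR distribution function $F$ and density $f$. Suppose $f$ is bounded in a neighbourhood of $0$, is differentiable on $(0,\infty)$, and satisfies $$f'\big(F^{-1}(x)\big) \le -\frac{f\big(F^{-1}(x)\big)}{1+F^{-1}(x)} \quad\text{for all } x \in [0,1)$$ (with $F^{-1}(0)=0$). Then the ergodic sum rate $R(\vec p)$, viewed as a function of the vector of feedback probabilities $\vec p=(p_1,\dots,p_n)\in[0,1]^n$, is Schur-concave on $[0,1]^n$.
   Context: System model: there are $n\ge 2$ users and $M\ge1$ beams. The SINR of user $i$ on beam $m$ is $\gamma_{i,m} = |X_{i,m}|^2 / \big(\tfrac1\rho + \sum_{k\ne m}|X_{i,k}|^2\big)$ with $\rho>0$. The vectors $(\gamma_{i,1},\dots,\gamma_{i,M})$, $i=1,\dots,n$, are i.i.d. across users; within a user the $\gamma_{i,m}$ are identically distributed (possibly dependent) with common marginal distribution function $F$, which is continuous with density $f$ whose support is $[0,\infty)$. Each user $i$ has a threshold $\tau_i\in[0,\infty]$ and reports, for each beam $m$, the truncated SINR $\bar\gamma_{i,m} = \gamma_{i,m}\mathbf 1\{\gamma_{i,m}\ge\tau_i\}$. The base station schedules on each beam the user with the largest reported SINR, giving ergodic sum rate $R(\vec\tau) = \mathbb{E}\big[\sum_{m=1}^M \log(1+\max_{1\le i\le n}\bar\gamma_{i,m})\big]$. The feedback probability of user $i$ is $p_i = \Pr\{\gamma_{i,1}\ge\tau_i\} = 1-F(\tau_i)$; since $\tau_i = F^{-1}(1-p_i)$ (with $F^{-1}(1)=+\infty$),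 $R$ may be regarded as a function $R(\vec p)$ of $\vec p\in[0,1]^n$. Majorization: for $\vec x,\vec y\in\mathbb R^n$ with decreasingly ordered coordinates $x_{[1]}\ge\dots\ge x_{[n]}$, $\vec x$ majorizes $\vec y$ if $\sum_{i=1}^j x_{[i]}\ge\sum_{i=1}^j y_{[i]}$ for $j=1,\dots,n-1$ and $\sum_{i=1}^n x_{[i]} = \sum_{i=1}^n y_{[i]}$. A function $\varphi$ is Schur-concave if $\vec x$ majorizing $\vec y$ implies $\varphi(\vec x)\le\varphi(\vec y)$. *)

theory Defs
  imports "HOL-Probability.Probability"
begin

text \<open>SINR of user i on beam m (beams indexed by 0..<M).\<close>
definition sinr :: "real \<Rightarrow> nat \<Rightarrow> (nat \<Rightarrow> nat \<Rightarrow> 'a \<Rightarrow> complex) \<Rightarrow> nat \<Rightarrow> nat \<Rightarrow> 'a \<Rightarrow> real" where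
  "sinr \<rho> M X i m \<omega> =
     (cmod (X i m \<omega>))\<^sup>2 / (1 / \<rho> + (\<Sum>k\<in>{..<M} - {m}. (cmod (X i k \<omega>))\<^sup>2))"

text \<open>Inverse of the distribution function on [0,1), with Finv F 0 = 0.\<close>
definition Finv :: "(real \<Rightarrow> real) \<Rightarrow> real \<Rightarrow> real" where
  "Finv F y = (THE t. 0 \<le> t \<and> F t = y)"

text \<open>Threshold tau = F^{-1}(1 - p), with F^{-1}(1) = +infinity.\<close>
definition threshold :: "(real \<Rightarrow> real) \<Rightarrow> real \<Rightarrow> ereal" where
  "threshold F p = (if p = 0 then \<infinity> else ereal (Finv F (1 - p)))"

definition truncated :: "real \<Rightarrow> ereal \<Rightarrow> real" where
  "truncated g \<tau> = (if \<tau> \<le> ereal g then g else 0)"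

definition sum_rate :: "'a measure \<Rightarrow> nat \<Rightarrow> nat \<Rightarrow> (real \<Rightarrow> real)
    \<Rightarrow> (nat \<Rightarrow> nat \<Rightarrow> 'a \<Rightarrow> real) \<Rightarrow> (nat \<Rightarrow> real) \<Rightarrow> ennreal" where
  "sum_rate P n M F \<gamma> p =
     (\<integral>\<^sup>+ \<omega>. ennreal (\<Sum>m<M. ln (1 + Max ((\<lambda>i. truncated (\<gamma> i m \<omega>) (threshold F (p i))) ` {..<n}))) \<partial>P)"

definition decr :: "nat \<Rightarrow> (nat \<Rightarrow> real) \<Rightarrow> real list" where
  "decr n x = rev (sort (map x [0..<n]))"

definition majorizes :: "nat \<Rightarrow> (nat \<Rightarrow> real) \<Rightarrow> (nat \<Rightarrow> real) \<Rightarrow> bool" where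
  "majorizes n x y \<longleftrightarrow>
     (\<forall>j\<in>{1..<n}. (\<Sum>i<j. decr n y ! i) \<le> (\<Sum>i<j. decr n x ! i)) \<and>
     (\<Sum>i<n. decr n x ! i) = (\<Sum>i<n. decr n y ! i)"

definition schur_concave_on :: "nat \<Rightarrow> (nat \<Rightarrow> real) set \<Rightarrow> ((nat \<Rightarrow> real) \<Rightarrow> 'b::order) \<Rightarrow> bool" where
  "schur_concave_on n S \<phi> \<longleftrightarrow> (\<forall>x\<in>S. \<forall>y\<in>S. majorizes n x y \<longrightarrow> \<phi> x \<le> \<phi> y)"

end

theory Submission
  imports Defs
begin

text \<open>Since \<open>ln (1 + y)\<close> is the integral of \<open>1 / (1 + t)\<close> over \<open>[0, y]\<close> and a truncated SINR is at most
  \<open>t\<close> with probability \<open>max (F t) (1 - p\<^sub>i)\<close>, each beam contributes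
  \<open>\<integral> (1 - \<Prod>\<^sub>i max (F t) (1 - p\<^sub>i)) / (1 + t) dt\<close> to the rate. By the theorem of Hardy, Littlewood and
  Polya it suffices to see what moving \<open>\<delta>\<close> from a larger to a smaller coordinate of \<open>p\<close> does.
  The product of the two affected factors changes by a function of \<open>u = F t\<close> that is first positive, then
  negative, and whose integral over \<open>0 \<le> u \<le> 1\<close> is at most zero. The condition on \<open>f\<close> says that
  \<open>(1 + t) f t\<close> is nonincreasing, so in the variable \<open>u\<close> the remaining weight, namely the other factors
  divided by \<open>(1 + t) f t\<close>, is nondecreasing; comparing it with its value at the sign change shows that
  the transfer decreases the integral of the weighted product.\<close>

section \<open>Majorization: reducing Schur-concavity to transfers between two coordinates\<close>

text \<open>Induction on the number of coordinates in which \<open>x\<close> and \<open>y\<close>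
  differ. Each step makes a transfer that settles at least one of them, disturbs none already
  settled, and keeps the decreasing order and the domination of partial sums, so that the hypotheses
  hold again for the new vector.\<close>

lemma transfer_imp_le_of_sorted:
  fixes \<phi> :: "(nat \<Rightarrow> real) \<Rightarrow> 'b::order"
  assumes cong: "\<And>x y. (\<And>i. i < n \<Longrightarrow> x i = y i) \<Longrightarrow> \<phi> x = \<phi> y"
    and transfer: "\<And>x j k \<delta>. \<lbrakk>\<forall>i<n. x i \<in> {l..u}; j < n; k < n; j \<noteq> k; 0 < \<delta>; x k + \<delta> \<le> x j - \<delta>\<rbrakk>
        \<Longrightarrow> \<phi> x \<le> \<phi> (x(j := x j - \<delta>, k := x k + \<delta>))"
    and y_sorted: "\<And>i j. i \<le> j \<Longrightarrow> j < n \<Longrightarrow> y j \<le> y i"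
    and "\<forall>i<n. x i \<in> {l..u}"
    and "\<And>i j. i \<le> j \<Longrightarrow> j < n \<Longrightarrow> x j \<le> x i"
    and "\<And>m. m \<le> n \<Longrightarrow> (\<Sum>i<m. y i) \<le> (\<Sum>i<m. x i)"
    and "(\<Sum>i<n. x i) = (\<Sum>i<n. y i)"
  shows "\<phi> x \<le> \<phi> y"
  using assms(4-)
proof (induction "card {i. i < n \<and> x i \<noteq> y i}" arbitrary: x rule: less_induct)
  case less
  note box = less.prems(1) and x_sorted = less.prems(2) and part = less.prems(3) and total = less.prems(4)
  show ?case
  proof (cases "\<forall>i<n. x i = y i")
    case True
    then show ?thesis using cong[of x y] by simp
  next
    case False
    have "\<exists>k. k < n \<and> x k < y k"
    proof (rule ccontr)
      assume "\<not> ?thesis"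
      then have ge: "\<And>i. i < n \<Longrightarrow> y i \<le> x i" by force
      moreover obtain i where "i < n" "x i \<noteq> y i" using False by blast
      ultimately have "(\<Sum>i<n. y i) < (\<Sum>i<n. x i)"
        by (intro sum_strict_mono_ex1) (auto intro!: bexI[of _ i] simp: order_less_le)
      then show False using total by simp
    qed
    \<comment> \<open>\<open>k\<close> is the first coordinate in deficit, and \<open>j\<close> will
      be the last one in surplus before it. Strictly between them \<open>x\<close> and
      \<open>y\<close> agree, which keeps the new vector sorted.\<close>
    define k where "k = (LEAST k. k < n \<and> x k < y k)"
    have k: "k < n" "x k < y k"
      using LeastI_ex[OF \<open>\<exists>k. k < n \<and> x k < y k\<close>] unfolding k_def by auto
    have ge: "y i \<le> x i" if "i < k" for i
      using not_less_Least[of i "\<lambda>k. k < n \<and> x k < y k"] that k(1) unfolding k_def[symmetric] by force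
    \<comment> \<open>With no surplus before \<open>k\<close>, the deficit at \<open>k\<close> would
      push the partial sum of \<open>x\<close> through \<open>k\<close> below that of
      \<open>y\<close>.\<close>
    have ex_j: "\<exists>j. j < k \<and> y j < x j"
    proof (rule ccontr)
      assume "\<not> ?thesis"
      then have "(\<Sum>i<k. x i) \<le> (\<Sum>i<k. y i)" by (intro sum_mono) force
      moreover have "(\<Sum>i<Suc k. y i) \<le> (\<Sum>i<Suc k. x i)" using part k(1) by (intro part) simp
      ultimately show False using k(2) by simp
    qed
    define j where "j = (GREATEST j. j < k \<and> y j < x j)"
    have j: "j < k" "y j < x j"
      using GreatestI_ex_nat[OF ex_j, of k] unfolding j_def by auto
    have eq: "x i = y i" if "j < i" "i < k" for i
    proof (rule ccontr)
      assume "x i \<noteq> y i"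
      then have "i \<le> j" unfolding j_def
        using ge[of i] that by (intro Greatest_le_nat[of _ _ k]) auto
      then show False using that by simp
    qed
    \<comment> \<open>The largest amount that overshoots neither target, so one of the two
      coordinates reaches its target exactly.\<close>
    define \<delta> where "\<delta> = min (x j - y j) (y k - x k)"
    have \<delta>: "0 < \<delta>" "\<delta> \<le> x j - y j" "\<delta> \<le> y k - x k" using j k by (auto simp: \<delta>_def)
    define x' where "x' = x(j := x j - \<delta>, k := x k + \<delta>)"
    have jk: "j < n" "j \<noteq> k" using j k by auto
    have x'_eq: "x' i = x i - (if i = j then \<delta> else 0) + (if i = k then \<delta> else 0)" for i
      using jk by (auto simp: x'_def)
    have yjk: "y k \<le> y j" using y_sorted[of j k] j k by simp
    \<comment> \<open>The chain is
      \<open>x k + \<delta> \<le> y k \<le> y j \<le> x j - \<delta>\<close>.\<close>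
    have gap: "x k + \<delta> \<le> x j - \<delta>" using yjk \<delta> by linarith
    have "\<phi> x \<le> \<phi> x'"
      unfolding x'_def using transfer[OF box jk(1) k(1) jk(2) \<delta>(1) gap] .
    also have "\<phi> x' \<le> \<phi> y"
    proof (rule less.hyps)
      have "{i. i < n \<and> x' i \<noteq> y i} \<subset> {i. i < n \<and> x i \<noteq> y i}"
      proof (rule psubsetI)
        show "{i. i < n \<and> x' i \<noteq> y i} \<subseteq> {i. i < n \<and> x i \<noteq> y i}"
          using j k by (auto simp: x'_eq)
        have "x' j = y j \<or> x' k = y k" using jk by (auto simp: x'_eq \<delta>_def)
        moreover have "j \<in> {i. i < n \<and> x i \<noteq> y i}" "k \<in> {i. i < n \<and> x i \<noteq> y i}"
          using j(2) k jk(1) by auto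
        ultimately show "{i. i < n \<and> x' i \<noteq> y i} \<noteq> {i. i < n \<and> x i \<noteq> y i}"
          by blast
      qed
      then show "card {i. i < n \<and> x' i \<noteq> y i} < card {i. i < n \<and> x i \<noteq> y i}"
        by (intro psubset_card_mono) auto
    next
      have "x j \<in> {l..u}" "x k \<in> {l..u}" using box jk k by auto
      then show "\<forall>i<n. x' i \<in> {l..u}" using box gap \<delta> by (auto simp: x'_def)
    next
      fix i m assume im: "i \<le> m" "m < n"
      have a: "x m \<le> x i" using x_sorted im by simp
      have b: "y m \<le> y i" using y_sorted im by simp
      \<comment> \<open>Only two comparisons are at risk: the lowered entry \<open>j\<close> against
        a later one, and the raised entry \<open>k\<close> against an earlier one. Between
        \<open>j\<close> and \<open>k\<close> the entries are those of the sorted \<open>y\<close>;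
        outside, the order of \<open>x\<close> together with \<open>gap\<close> suffices.\<close>
      show "x' m \<le> x' i"
      proof (cases "i = j \<and> m \<noteq> j")
        case True
        then have "j < m" using im by simp
        then consider "m < k" | "m = k" | "k < m" by linarith
        then show ?thesis
        proof cases
          case 1
          then show ?thesis using True eq[of m] \<open>j < m\<close> b \<delta> by (simp add: x'_eq)
        next
          case 2
          then show ?thesis using True gap by (simp add: x'_eq)
        next
          case 3
          then have "x m \<le> x k" using x_sorted im by simp
          then show ?thesis using True gap 3 \<delta> jk by (simp add: x'_eq)
        qed
      next
        case False
        note nj = this
        show ?thesis
        proof (cases "m = k \<and> i \<noteq> k")
          case True
          then have "i < k" using im by simp
          then consider "i < j" | "i = j" | "j < i" by linarith
          then show ?thesis
          proof cases
            case 1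
            then have "x j \<le> x i" using x_sorted jk by simp
            then show ?thesis using True gap 1 \<delta> jk by (simp add: x'_eq)
          next
            case 2
            then show ?thesis using nj True by auto
          next
            case 3
            then show ?thesis using True eq[of i] \<open>i < k\<close> b \<delta> by (simp add: x'_eq)
          qed
        next
          case False
          then show ?thesis using nj a \<delta> by (auto simp: x'_eq)
        qed
      qed
    next
      have sum_x': "(\<Sum>i<m. x' i) = (\<Sum>i<m. x i) - (if j < m then \<delta> else 0) + (if k < m then \<delta> else 0)" for m
        by (simp add: x'_eq sum.distrib sum_subtractf)
      show "(\<Sum>i<n. x' i) = (\<Sum>i<n. y i)" using total jk k by (simp add: sum_x')
      fix m assume m: "m \<le> n"
      \<comment> \<open>Only partial sums that contain \<open>j\<close> but not \<open>k\<close>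
        lose \<delta>. There the surplus at \<open>j\<close> alone pays for it, as no entry before
        \<open>k\<close> is in deficit.\<close>
      show "(\<Sum>i<m. y i) \<le> (\<Sum>i<m. x' i)"
      proof (cases "j < m \<and> m \<le> k")
        case True
        have "x j - y j \<le> (\<Sum>i<m. x i - y i)"
          using True ge by (intro member_le_sum[where f = "\<lambda>i. x i - y i"]) auto
        then show ?thesis using True \<delta> by (simp add: sum_x' sum_subtractf)
      next
        case False
        then show ?thesis using part[OF m] j by (auto simp: sum_x')
      qed
    qed
    finally show ?thesis .
  qed
qed

lemma length_decr [simp]: "length (decr n x) = n"
  by (simp add: decr_def)

lemma decr_antimono:
  assumes "i \<le> j" "j < n"
  shows "decr n x ! j \<le> decr n x ! i"
proof -
  have "sorted (rev (decr n x))" by (simp add: decr_def)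
  then show ?thesis using sorted_rev_nth_mono[of "decr n x" i j] assms by simp
qed

lemma decr_permutes:
  obtains \<pi> where "\<pi> permutes {..<n}" "\<And>i. i < n \<Longrightarrow> decr n x ! i = x (\<pi> i)"
proof -
  have "mset (decr n x) = mset (map x [0..<n])" by (simp add: decr_def)
  then obtain \<pi> where \<pi>: "\<pi> permutes {..<length (map x [0..<n])}" "permute_list \<pi> (map x [0..<n]) = decr n x"
    by (rule mset_eq_permutation)
  show thesis
  proof
    show perm: "\<pi> permutes {..<n}" using \<pi>(1) by simp
    fix i assume "i < n"
    then have "\<pi> i < n" using permutes_in_image[OF perm] by auto
    then show "decr n x ! i = x (\<pi> i)"
      using \<pi> \<open>i < n\<close> permute_list_nth[OF \<pi>(1), of i] by simp
  qed
qed

text \<open>Symmetry replaces both vectors by their decreasing rearrangements. \<open>cong\<close>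
  is a separate premise because vectors are functions on all of \<open>nat\<close>, while
  \<open>decr n x ! i\<close> is unspecified for \<open>i \<ge> n\<close>.\<close>

lemma schur_concave_onI_transfer:
  fixes \<phi> :: "(nat \<Rightarrow> real) \<Rightarrow> 'b::order"
  assumes cong: "\<And>x y. (\<And>i. i < n \<Longrightarrow> x i = y i) \<Longrightarrow> \<phi> x = \<phi> y"
    and symm: "\<And>x \<pi>. \<lbrakk>\<forall>i<n. x i \<in> {l..u}; \<pi> permutes {..<n}\<rbrakk> \<Longrightarrow> \<phi> (x \<circ> \<pi>) = \<phi> x"
    and transfer: "\<And>x j k \<delta>. \<lbrakk>\<forall>i<n. x i \<in> {l..u}; j < n; k < n; j \<noteq> k; 0 < \<delta>; x k + \<delta> \<le> x j - \<delta>\<rbrakk>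
        \<Longrightarrow> \<phi> x \<le> \<phi> (x(j := x j - \<delta>, k := x k + \<delta>))"
  shows "schur_concave_on n {x. \<forall>i<n. x i \<in> {l..u}} \<phi>"
proof -
  have decr: "\<phi> ((!) (decr n x)) = \<phi> x \<and> (\<forall>i<n. decr n x ! i \<in> {l..u})" if x: "\<forall>i<n. x i \<in> {l..u}" for x
  proof -
    obtain \<pi> where \<pi>: "\<pi> permutes {..<n}" "\<And>i. i < n \<Longrightarrow> decr n x ! i = x (\<pi> i)"
      using decr_permutes[of n x] by blast
    have "\<phi> ((!) (decr n x)) = \<phi> (x \<circ> \<pi>)" using \<pi>(2) by (intro cong) simp
    then show ?thesis using symm[OF x \<pi>(1)] x \<pi> permutes_in_image[OF \<pi>(1)] by auto
  qed
  show ?thesis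
    unfolding schur_concave_on_def
  proof (intro ballI impI)
    fix x y assume "x \<in> {x. \<forall>i<n. x i \<in> {l..u}}" "y \<in> {x. \<forall>i<n. x i \<in> {l..u}}" and maj: "majorizes n x y"
    then have xy: "\<forall>i<n. x i \<in> {l..u}" "\<forall>i<n. y i \<in> {l..u}" by auto
    have "\<phi> ((!) (decr n x)) \<le> \<phi> ((!) (decr n y))"
    proof (rule transfer_imp_le_of_sorted[where n = n and l = l and u = u])
      fix m assume "m \<le> n"
      then consider "m = 0" | "m \<in> {1..<n}" | "m = n" by force
      then show "(\<Sum>i<m. decr n y ! i) \<le> (\<Sum>i<m. decr n x ! i)"
        using maj unfolding majorizes_def by cases auto
    next
      show "\<forall>i<n. decr n x ! i \<in> {l..u}" using decr[OF xy(1)] by blast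
      show "(\<Sum>i<n. decr n x ! i) = (\<Sum>i<n. decr n y ! i)" using maj by (simp add: majorizes_def)
    qed (fact cong transfer | erule (1) decr_antimono)+
    then show "\<phi> x \<le> \<phi> y" using decr xy by simp
  qed
qed

section \<open>The product \<open>max u a * max u b\<close>: its antiderivative and the effect of
  spreading \<open>a\<close> and \<open>b\<close>\<close>

text \<open>An exponent of at least 2 smooths the kink at \<open>a\<close>: with
  \<open>v = u - a\<close> the power factors as \<open>max v 0 ^ Suc k * v\<close>, and
  Caratheodory's criterion gives derivative 0 there. Away from \<open>a\<close> the function is
  locally a polynomial.\<close>

lemma has_real_derivative_pos_part_power:
  "((\<lambda>u::real. max (u - a) 0 ^ Suc (Suc k)) has_real_derivative (real k + 2) * max (u - a) 0 ^ Suc k) (at u)"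
proof -
  consider "u < a" | "u = a" | "a < u" by linarith
  then show ?thesis
  proof cases
    case 1
    have "((\<lambda>u. 0) has_real_derivative 0) (at u)" by simp
    then have "((\<lambda>u::real. max (u - a) 0 ^ Suc (Suc k)) has_real_derivative 0) (at u)"
      by (rule has_field_derivative_transform_within_open[where S = "{..<a}"]) (use 1 in auto)
    then show ?thesis using 1 by simp
  next
    case 2
    have "isCont (\<lambda>z::real. max (z - a) 0 ^ Suc k) a" by (intro continuous_intros)
    moreover have "max v 0 ^ Suc (Suc k) = max v 0 ^ Suc k * v" for v :: real
      by (cases "v \<le> 0") (auto simp: max_def)
    ultimately have "((\<lambda>u::real. max (u - a) 0 ^ Suc (Suc k)) has_real_derivative 0) (at a)"
      by (subst CARAT_DERIV) (auto intro!: exI[of _ "\<lambda>z::real. max (z - a) 0 ^ Suc k"] simp del: power_Suc)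
    then show ?thesis using 2 by simp
  next
    case 3
    have "((\<lambda>u. (u - a) ^ Suc (Suc k)) has_real_derivative (real k + 2) * (u - a) ^ Suc k) (at u)"
      using DERIV_power_Suc[of "\<lambda>u. u - a" 1 u UNIV "Suc k"]
      by (auto intro!: derivative_eq_intros simp: algebra_simps simp del: power_Suc)
    then have "((\<lambda>u::real. max (u - a) 0 ^ Suc (Suc k)) has_real_derivative (real k + 2) * (u - a) ^ Suc k) (at u)"
      by (rule has_field_derivative_transform_within_open[where S = "{a<..}"]) (use 3 in auto)
    then show ?thesis using 3 by simp
  qed
qed

text \<open>Found by writing each \<open>max u c\<close> as \<open>c + max (u - c) 0\<close>,
  expanding the product for \<open>b \<le> a\<close> and integrating. A single formula on the whole
  line avoids splitting integrals at \<open>a\<close> and \<open>b\<close>.\<close>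

definition max_max_antideriv :: "real \<Rightarrow> real \<Rightarrow> real \<Rightarrow> real" where
  "max_max_antideriv a b u = a * b * u + a / 2 * max (u - b) 0 ^ 2 + a / 2 * max (u - a) 0 ^ 2 + max (u - a) 0 ^ 3 / 3"

lemma has_real_derivative_max_max_antideriv:
  assumes "b \<le> a"
  shows "(max_max_antideriv a b has_real_derivative max u a * max u b) (at u)"
proof -
  have 2: "((\<lambda>u. max (u - c) 0 ^ 2) has_real_derivative 2 * max (u - c) 0) (at u)" for c
    using has_real_derivative_pos_part_power[of c 0 u] by (simp add: numeral_2_eq_2)
  have 3: "((\<lambda>u. max (u - c) 0 ^ 3) has_real_derivative 3 * max (u - c) 0 ^ 2) (at u)" for c
    using has_real_derivative_pos_part_power[of c 1 u] by (simp add: numeral_3_eq_3 numeral_2_eq_2)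
  have "(max_max_antideriv a b has_real_derivative
      a * b + a / 2 * (2 * max (u - b) 0) + a / 2 * (2 * max (u - a) 0) + (3 * max (u - a) 0 ^ 2) / 3) (at u)"
    unfolding max_max_antideriv_def[abs_def]
    by (intro DERIV_add DERIV_cmult DERIV_cdivide 2 3 DERIV_cmult_Id)
  moreover have "a * b + a / 2 * (2 * max (u - b) 0) + a / 2 * (2 * max (u - a) 0) + (3 * max (u - a) 0 ^ 2) / 3
     = max u a * max u b"
    using assms by (auto simp: max_def power2_eq_square algebra_simps)
  ultimately show ?thesis by simp
qed

text \<open>The threshold \<open>a * b / a'\<close> lies between \<open>b'\<close> and \<open>b\<close>, where the difference of the two
  products is \<open>a' * u - a * b\<close>.\<close>
lemma max_max_single_crossing:
  fixes a b a' b' u :: real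
  assumes "0 \<le> b'" "b' \<le> b" "b \<le> a" "a \<le> a'" "0 < a'" "a' + b' = a + b"
  shows "u \<le> a * b / a' \<Longrightarrow> max u a' * max u b' \<le> max u a * max u b"
    and "a * b / a' \<le> u \<Longrightarrow> max u a * max u b \<le> max u a' * max u b'"
proof -
  \<comment> \<open>Of two pairs with equal sum the more spread one has the smaller product; this
    puts the threshold at or above \<open>b'\<close>.\<close>
  have "a * b - a' * b' = (a - b') * (b - b')"
  proof -
    have "a' = a + b - b'" using assms(6) by simp
    show ?thesis unfolding \<open>a' = a + b - b'\<close> by (simp add: algebra_simps)
  qed
  moreover have "0 \<le> (a - b') * (b - b')" using assms by (intro mult_nonneg_nonneg) auto
  ultimately have lo: "a' * b' \<le> a * b" by simp
  have hi: "a * b / a' \<le> b" using assms by (simp add: field_simps mult_right_mono)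
  show "max u a' * max u b' \<le> max u a * max u b" if u: "u \<le> a * b / a'"
  proof -
    have "u \<le> b" using u hi by simp
    moreover have "a' * u \<le> a * b" using u assms by (simp add: field_simps)
    ultimately show ?thesis
      using assms lo by (auto simp: max_def mult.commute)
  qed
  show "max u a * max u b \<le> max u a' * max u b'" if u: "a * b / a' \<le> u"
  proof -
    have ab: "a * b \<le> a' * u" using u assms by (simp add: field_simps)
    have "b' \<le> a * b / a'" using lo assms by (simp add: field_simps)
    then have u: "b' \<le> u" using u by simp
    then have "max u b' = u" by simp
    moreover have "max u a * max u b \<le> max u a' * u"
    proof (cases "u \<le> b")
      case True
      then show ?thesis using assms ab by (simp add: max_def)
    next
      case False
      then show ?thesis using assms u by (auto intro!: mult_right_mono)
    qed
    ultimately show ?thesis by simp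
  qed
qed

section \<open>Analysis of the rate of one beam\<close>

text \<open>The analytic content of the hypotheses, detached from the probability model.
  \<open>weight_antimono\<close> is the integrated form of the condition on the derivative of
  \<open>f\<close>. \<open>F_deriv\<close> leaves out 0 because in the application \<open>F\<close>
  has a corner there: it vanishes to the left, while \<open>f 0\<close> is positive.\<close>

locale decaying_density =
  fixes F f :: "real \<Rightarrow> real"
  assumes F_deriv: "\<And>t. 0 < t \<Longrightarrow> (F has_real_derivative f t) (at t)"
    and F_cont: "continuous_on UNIV F"
    and F_0: "F 0 = 0"
    and F_at_top: "(F \<longlongrightarrow> 1) at_top"
    and f_cont: "\<And>t. 0 < t \<Longrightarrow> isCont f t"
    and f_pos: "\<And>t. 0 \<le> t \<Longrightarrow> 0 < f t"
    and weight_antimono: "\<And>s t. 0 \<le> s \<Longrightarrow> s \<le> t \<Longrightarrow> (1 + t) * f t \<le> (1 + s) * f s"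
begin

lemma F_strict_mono:
  assumes "0 \<le> s" "s < t"
  shows "F s < F t"
proof (rule DERIV_pos_imp_increasing_open[OF assms(2)])
  fix x assume "s < x" "x < t"
  then show "\<exists>y. (F has_real_derivative y) (at x) \<and> 0 < y"
    using assms F_deriv[of x] f_pos[of x] by (intro exI[of _ "f x"]) auto
qed (rule continuous_on_subset[OF F_cont], simp)

lemma F_mono: "0 \<le> s \<Longrightarrow> s \<le> t \<Longrightarrow> F s \<le> F t"
  using F_strict_mono[of s t] by (cases "s = t") auto

lemma F_less_1:
  assumes "0 \<le> t"
  shows "F t < 1"
proof -
  have "eventually (\<lambda>x. F (t + 1) \<le> F x) at_top"
    using eventually_ge_at_top[of "t + 1"] by eventually_elim (use assms in \<open>auto intro: F_mono\<close>)
  then have "F (t + 1) \<le> 1"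
    using tendsto_lowerbound[OF F_at_top] by simp
  then show ?thesis using F_strict_mono[of t "t + 1"] assms by simp
qed

lemma F_nonneg: "0 \<le> t \<Longrightarrow> 0 \<le> F t"
  using F_mono[of 0 t] F_0 by simp

lemma F_surj:
  assumes "0 \<le> u" "u < 1"
  obtains t where "0 \<le> t" "F t = u"
proof -
  have "eventually (\<lambda>t. u < F t \<and> 0 \<le> t) at_top"
    using order_tendstoD(1)[OF F_at_top assms(2)] eventually_ge_at_top by (rule eventually_conj)
  then obtain s where "u < F s" "0 \<le> s" by (auto simp: eventually_at_top_linorder)
  then have "\<exists>t\<ge>0. t \<le> s \<and> F t = u"
    using assms F_0 by (intro IVT') (auto intro: continuous_on_subset[OF F_cont])
  then show thesis using that by blast
qed

lemma F_borel [measurable]: "F \<in> borel_measurable borel"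
  using F_cont by (rule borel_measurable_continuous_onI)

text \<open>The substitution \<open>u = F t\<close> leads to the integral of
  \<open>max u a * max u b\<close> over \<open>0 \<le> u \<le> 1\<close>, evaluated by the
  fundamental theorem on an unbounded interval. That theorem also yields integrability and hence
  measurability, which has to be claimed because the locale says nothing about \<open>f\<close> on
  the negative axis.\<close>

lemma nn_integral_max_max:
  assumes "0 \<le> b" "b \<le> a" "a \<le> 1"
  shows "(\<lambda>t. ennreal (f t * (max (F t) a * max (F t) b)) * indicator {0<..} t) \<in> borel_measurable borel" (is ?meas)
    and "(\<integral>\<^sup>+t. ennreal (f t * (max (F t) a * max (F t) b)) * indicator {0<..} t \<partial>lborel)
      = ennreal (a * b\<^sup>2 / 2 + a ^ 3 / 6 + 1 / 3)" (is ?eq)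
proof -
  let ?g = "\<lambda>t. f t * (max (F t) a * max (F t) b)"
  let ?G = "\<lambda>t. max_max_antideriv a b (F t)"
  have isCont: "isCont (max_max_antideriv a b) u" for u
    using DERIV_isCont has_real_derivative_max_max_antideriv assms(2) by blast
  have einterval: "einterval (ereal 0) \<infinity> = {0<..}" by (auto simp: einterval_def)
  have deriv: "(?G has_real_derivative ?g t) (at t)" if "0 < t" for t
    using DERIV_chain2[OF has_real_derivative_max_max_antideriv[OF assms(2)] F_deriv[OF that]]
    by (simp add: mult.commute)
  have "(F \<longlongrightarrow> F 0) (at_right 0)"
    using F_cont continuous_on_def[of UNIV F] tendsto_within_subset[of F _ 0 UNIV "{0<..}"] by auto
  then have lim_0: "(?G \<longlongrightarrow> max_max_antideriv a b 0) (at_right 0)"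
    using isCont_tendsto_compose[OF isCont] F_0 by metis
  have lim_top: "(?G \<longlongrightarrow> max_max_antideriv a b 1) at_top"
    using isCont_tendsto_compose[OF isCont F_at_top] .
  have cont: "isCont ?g t" if "0 < t" for t
    using f_cont[OF that] DERIV_isCont[OF F_deriv[OF that]] by (intro continuous_intros) auto
  have nonneg: "0 \<le> ?g t" if "0 < t" for t
    using f_pos[of t] F_nonneg[of t] that by (intro mult_nonneg_nonneg) auto
  have FTC: "set_integrable lborel {0<..} ?g"
    "(LBINT t=ereal 0..\<infinity>. ?g t) = max_max_antideriv a b 1 - max_max_antideriv a b 0"
    using interval_integral_FTC_nonneg[of "ereal 0" \<infinity> ?G ?g "max_max_antideriv a b 0" "max_max_antideriv a b 1"]
      deriv cont nonneg lim_0 lim_top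
    by (simp_all add: ereal_tendsto_simps einterval)
  have eq: "ennreal (?g t) * indicator {0<..} t = ennreal (indicator {0<..} t * ?g t)" for t
    by (simp split: split_indicator)
  show ?meas
    unfolding eq using FTC(1) by (auto simp: set_integrable_def)
  have "(\<integral>\<^sup>+t. ennreal (?g t) * indicator {0<..} t \<partial>lborel) = ennreal (LBINT t:{0<..}. ?g t)"
    unfolding eq set_lebesgue_integral_def real_scaleR_def
    using FTC(1) nonneg by (intro nn_integral_eq_integral) (auto simp: set_integrable_def split: split_indicator)
  also have "(LBINT t:{0<..}. ?g t) = max_max_antideriv a b 1 - max_max_antideriv a b 0"
    using FTC(2) by (simp add: interval_lebesgue_integral_def einterval)
  also have "\<dots> = a * b\<^sup>2 / 2 + a ^ 3 / 6 + 1 / 3"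
    using assms by (simp add: max_max_antideriv_def max_absorb1 max_absorb2 power2_eq_square power3_eq_cube field_simps)
  finally show ?eq .
qed

text \<open>Extended values are used because the locale admits tails so heavy that the integral
  diverges.\<close>

definition beam_rate :: "nat \<Rightarrow> (nat \<Rightarrow> real) \<Rightarrow> ennreal" where
  "beam_rate n p = (\<integral>\<^sup>+t. ennreal ((1 - (\<Prod>i<n. max (F t) (1 - p i))) / (1 + t)) * indicator {0<..} t \<partial>lborel)"

lemma beam_rate_permutes: "\<pi> permutes {..<n} \<Longrightarrow> beam_rate n (p \<circ> \<pi>) = beam_rate n p"
  unfolding beam_rate_def
  by (subst (2) prod.permute[where p = \<pi>]) (simp_all add: comp_def)

text \<open>The untouched factors form a common multiplier \<open>G\<close>. To avoid subtracting
  possibly infinite rates, \<kappa> times the finite integral of \<open>f t * K t\<close> or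
  \<open>f t * K' t\<close> is added to either side; the sums are compared pointwise, and the finite
  term is cancelled at the end.\<close>

lemma beam_rate_transfer:
  assumes box: "\<forall>i<n. p i \<in> {0..1}" and jk: "j < n" "k < n" "j \<noteq> k"
    and \<delta>: "0 < \<delta>" "p k + \<delta> \<le> p j - \<delta>"
  shows "beam_rate n p \<le> beam_rate n (p(j := p j - \<delta>, k := p k + \<delta>))"
proof -
  define p' where "p' = p(j := p j - \<delta>, k := p k + \<delta>)"
  define a where "a = 1 - p k"
  define b where "b = 1 - p j"
  define a' where "a' = a - \<delta>"
  define b' where "b' = b + \<delta>"
  have pjk: "p j \<in> {0..1}" "p k \<in> {0..1}" using box jk by auto
  have ab: "0 \<le> b" "b < b'" "b' \<le> a'" "a' < a" "a \<le> 1" "a + b = a' + b'"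
    using pjk \<delta> by (auto simp: a_def b_def a'_def b'_def)
  define I where "I = {..<n} - {j, k}"
  define G where "G t = (\<Prod>i\<in>I. max (F t) (1 - p i))" for t
  define K where "K t = max (F t) a * max (F t) b" for t
  define K' where "K' t = max (F t) a' * max (F t) b'" for t
  have split: "(\<Prod>i<n. h i) = h k * h j * (\<Prod>i\<in>I. h i)" for h :: "nat \<Rightarrow> real"
  proof -
    have "{..<n} = insert k (insert j I)" "k \<notin> insert j I" "j \<notin> I" "finite I"
      using jk by (auto simp: I_def)
    then show ?thesis by (simp add: mult.assoc)
  qed
  have prod_p: "(\<Prod>i<n. max (F t) (1 - p i)) = K t * G t" for t
    by (simp add: split G_def K_def a_def b_def)
  have prod_p': "(\<Prod>i<n. max (F t) (1 - p' i)) = K' t * G t" for t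
  proof -
    have "(\<Prod>i\<in>I. max (F t) (1 - p' i)) = G t"
      unfolding G_def by (rule prod.cong) (auto simp: I_def p'_def)
    then show ?thesis
      using jk by (simp add: split K'_def p'_def a_def b_def a'_def b'_def algebra_simps)
  qed
  have G_nonneg: "0 \<le> G t" if "0 \<le> t" for t
    unfolding G_def using F_nonneg[OF that] by (intro prod_nonneg) auto
  have G_mono: "G s \<le> G t" if "0 \<le> s" "s \<le> t" for s t
    unfolding G_def using F_nonneg[OF that(1)] F_mono[OF that]
    by (intro prod_mono) auto
  \<comment> \<open>The crossing point of \<open>max_max_single_crossing\<close> with primed and
    unprimed letters exchanged: here \<open>a\<close>, \<open>b\<close> is the more spread
    pair.\<close>
  define u where "u = a' * b' / a"
  have u: "0 \<le> u" "u < 1"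
  proof -
    show "0 \<le> u" using ab by (auto simp: u_def)
    have "a' * b' \<le> a * b'" using ab by (intro mult_right_mono) auto
    also have "\<dots> < a * 1" using ab by (intro mult_strict_left_mono) auto
    finally show "u < 1" using ab by (simp add: u_def)
  qed
  obtain t0 where t0: "0 \<le> t0" "F t0 = u" using F_surj[OF u] .
  \<comment> \<open>The weight at the sign change \<open>t0\<close>.\<close>
  define \<kappa> where "\<kappa> = G t0 / ((1 + t0) * f t0)"
  have \<kappa>: "0 \<le> \<kappa>" using G_nonneg f_pos[of t0] t0 by (simp add: \<kappa>_def)
  have K_nonneg: "0 \<le> K t" "0 \<le> K' t" if "0 < t" for t
    using F_nonneg[of t] that by (auto simp: K_def K'_def intro!: mult_nonneg_nonneg)
  \<comment> \<open>Splitting off \<open>f t\<close>, the Jacobian of \<open>u = F t\<close>,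
    exposes the weight in the variable \<open>u\<close>.\<close>
  have G_weight: "G t / (1 + t) = f t * (G t / ((1 + t) * f t))" if "0 < t" for t
    using f_pos[of t] that by simp
  have pointwise: "(1 - K t * G t) / (1 + t) + \<kappa> * (f t * K t) \<le> (1 - K' t * G t) / (1 + t) + \<kappa> * (f t * K' t)"
    if t: "0 < t" for t
  proof -
    have pos: "0 < (1 + t) * f t" "0 < (1 + t0) * f t0" using f_pos t t0 by auto
    \<comment> \<open>Both factors pass from nonpositive to nonnegative at \<open>t0\<close>, so
      they never have opposite signs.\<close>
    have "0 \<le> (G t / ((1 + t) * f t) - \<kappa>) * (K t - K' t)"
    proof (cases "t \<le> t0")
      case True
      then have "F t \<le> u" using F_mono[of t t0] t t0 by simp
      then have "K t \<le> K' t"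
        unfolding K_def K'_def u_def using ab by (intro max_max_single_crossing(1)) auto
      moreover have "G t / ((1 + t) * f t) \<le> \<kappa>"
        unfolding \<kappa>_def using True t pos G_mono[of t t0] G_nonneg[of t0] t0 weight_antimono[of t t0]
        by (intro frac_le) auto
      ultimately show ?thesis by (intro mult_nonpos_nonpos) auto
    next
      case False
      then have "u \<le> F t" using F_mono[of t0 t] t t0 by simp
      then have "K' t \<le> K t"
        unfolding K_def K'_def u_def using ab by (intro max_max_single_crossing(2)) auto
      moreover have "\<kappa> \<le> G t / ((1 + t) * f t)"
        unfolding \<kappa>_def using False t pos G_mono[of t0 t] G_nonneg[of t] t0 weight_antimono[of t0 t]
        by (intro frac_le) auto
      ultimately show ?thesis by (intro mult_nonneg_nonneg) auto
    qed
    then have "0 \<le> f t * ((G t / ((1 + t) * f t) - \<kappa>) * (K t - K' t))"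
      using f_pos[of t] t by simp
    also have "\<dots> = (G t / (1 + t)) * (K t - K' t) - \<kappa> * (f t * (K t - K' t))"
      using G_weight[OF t] by (simp add: algebra_simps)
    finally show ?thesis by (simp add: diff_divide_distrib algebra_simps)
  qed
  \<comment> \<open>Since \<open>ennreal\<close> sends negative numbers to 0, the real inequality
    carries over only once the integrands are known to be nonnegative.\<close>
  have q_nonneg: "0 \<le> (1 - (\<Prod>i<n. max (F t) (1 - q i))) / (1 + t)" if "0 < t" "\<forall>i<n. q i \<in> {0..1}" for t q
  proof -
    have "(\<Prod>i<n. max (F t) (1 - q i)) \<le> 1"
      using that F_nonneg[of t] F_less_1[of t] by (intro prod_le_1) (auto simp: max_def)
    then show ?thesis using that by simp
  qed
  have box': "\<forall>i<n. p' i \<in> {0..1}" using box pjk \<delta> by (auto simp: p'_def)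
  let ?J = "\<lambda>K. \<integral>\<^sup>+t. ennreal (f t * K t) * indicator {0<..} t \<partial>lborel"
  have meas [measurable]: "(\<lambda>t. ennreal (f t * K t) * indicator {0<..} t) \<in> borel_measurable borel"
    "(\<lambda>t. ennreal (f t * K' t) * indicator {0<..} t) \<in> borel_measurable borel"
    unfolding K_def K'_def using ab by (intro nn_integral_max_max(1); simp)+
  have J: "?J K = ennreal (a * b\<^sup>2 / 2 + a ^ 3 / 6 + 1 / 3)" "?J K' = ennreal (a' * b'\<^sup>2 / 2 + a' ^ 3 / 6 + 1 / 3)"
    unfolding K_def K'_def using ab by (intro nn_integral_max_max(2); simp)+
  have J_le: "?J K' \<le> ?J K"
  proof -
    \<comment> \<open>In terms of the half sum \<open>s\<close> and half difference \<open>d\<close>, the integral is \<open>2/3 (s^3 + d^3) + 1/3\<close>.\<close>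
    have "x * y\<^sup>2 / 2 + x ^ 3 / 6 = 2 / 3 * ((x + y) / 2) ^ 3 + 2 / 3 * ((x - y) / 2) ^ 3" for x y :: real
      by (simp add: power2_eq_square power3_eq_cube field_simps)
    moreover have "((a' - b') / 2) ^ 3 \<le> ((a - b) / 2) ^ 3" using ab by (intro power_mono) auto
    ultimately show ?thesis unfolding J using ab by (intro ennreal_leI) simp
  qed
  have rate_meas [measurable]: "(\<lambda>t. ennreal ((1 - (\<Prod>i<n. max (F t) (1 - q i))) / (1 + t)) * indicator {0<..} t)
      \<in> borel_measurable borel" for q by measurable
  have "beam_rate n p + ennreal \<kappa> * ?J K = (\<integral>\<^sup>+t. ennreal ((1 - (\<Prod>i<n. max (F t) (1 - p i))) / (1 + t)) * indicator {0<..} t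
      + ennreal \<kappa> * (ennreal (f t * K t) * indicator {0<..} t) \<partial>lborel)"
    unfolding beam_rate_def by (subst nn_integral_add) (auto simp: nn_integral_cmult)
  also have "\<dots> \<le> (\<integral>\<^sup>+t. ennreal ((1 - (\<Prod>i<n. max (F t) (1 - p' i))) / (1 + t)) * indicator {0<..} t
      + ennreal \<kappa> * (ennreal (f t * K' t) * indicator {0<..} t) \<partial>lborel)"
  proof (rule nn_integral_mono)
    fix t :: real
    show "ennreal ((1 - (\<Prod>i<n. max (F t) (1 - p i))) / (1 + t)) * indicator {0<..} t
        + ennreal \<kappa> * (ennreal (f t * K t) * indicator {0<..} t)
      \<le> ennreal ((1 - (\<Prod>i<n. max (F t) (1 - p' i))) / (1 + t)) * indicator {0<..} t
        + ennreal \<kappa> * (ennreal (f t * K' t) * indicator {0<..} t)"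
    proof (cases "0 < t")
      case True
      have "0 \<le> f t * K t" "0 \<le> f t * K' t" using f_pos[of t] K_nonneg True by auto
      then show ?thesis
        using True pointwise[OF True] q_nonneg[OF True box] q_nonneg[OF True box'] \<kappa>
        by (simp add: prod_p prod_p' ennreal_mult[symmetric] ennreal_plus[symmetric] ennreal_leI del: ennreal_plus)
    qed simp
  qed
  also have "\<dots> = beam_rate n p' + ennreal \<kappa> * ?J K'"
    unfolding beam_rate_def by (subst nn_integral_add) (auto simp: nn_integral_cmult)
  also have "\<dots> \<le> beam_rate n p' + ennreal \<kappa> * ?J K"
    using J_le by (intro add_left_mono mult_left_mono) auto
  \<comment> \<open>The term \<open>ennreal \<kappa> * ?J K\<close> is finite by \<open>J\<close>,
    so it cancels even when the rates are infinite.\<close>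
  finally show ?thesis
    unfolding p'_def[symmetric] J using ab
    by (simp add: ennreal_mult[symmetric] \<kappa> ennreal_add_left_cancel_le add.commute del: ennreal_plus)
qed

lemma schur_concave_on_beam_rate: "schur_concave_on n {p. \<forall>i<n. p i \<in> {0..1}} (beam_rate n)"
proof (rule schur_concave_onI_transfer)
  fix p q :: "nat \<Rightarrow> real" assume "\<And>i. i < n \<Longrightarrow> p i = q i"
  then show "beam_rate n p = beam_rate n q" by (simp add: beam_rate_def)
next
  fix p :: "nat \<Rightarrow> real" and \<pi> assume "\<pi> permutes {..<n}"
  then show "beam_rate n (p \<circ> \<pi>) = beam_rate n p" by (rule beam_rate_permutes)
next
  fix p :: "nat \<Rightarrow> real" and j k \<delta>
  assume "\<forall>i<n. p i \<in> {0..1}" "j < n" "k < n" "j \<noteq> k" "0 < \<delta>" "p k + \<delta> \<le> p j - \<delta>"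
  then show "beam_rate n p \<le> beam_rate n (p(j := p j - \<delta>, k := p k + \<delta>))" by (rule beam_rate_transfer)
qed

end

section \<open>Expected logarithms as integrals over levels, and the law of the truncated
  SINRs\<close>

text \<open>The interval is open so that membership splits into \<open>0 < t\<close> and
  \<open>t < y\<close>, the latter being the event needed once \<open>y\<close> is random. The
  endpoints form a null set.\<close>

lemma ennreal_ln_1_plus_eq_nn_integral:
  assumes "0 \<le> y"
  shows "ennreal (ln (1 + y)) = (\<integral>\<^sup>+t. ennreal (1 / (1 + t)) * indicator {0<..<y} t \<partial>lborel)"
proof -
  have "(\<integral>\<^sup>+t. ennreal (1 / (1 + t)) * indicator {0<..<y} t \<partial>lborel)
    = (\<integral>\<^sup>+t. ennreal (1 / (1 + t)) * indicator {0..y} t \<partial>lborel)"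
  proof (rule nn_integral_cong_AE)
    have "AE t in lborel. t \<noteq> 0 \<and> t \<noteq> y"
      using AE_lborel_singleton[of 0] AE_lborel_singleton[of y] by eventually_elim simp
    then show "AE t in lborel. ennreal (1 / (1 + t)) * indicator {0<..<y} t = ennreal (1 / (1 + t)) * indicator {0..y} t"
      by eventually_elim (auto split: split_indicator)
  qed
  also have "\<dots> = ennreal (ln (1 + y) - ln (1 + 0))"
    by (rule nn_integral_FTC_Icc[OF _ _ _ assms]) (auto intro!: derivative_eq_intros)
  finally show ?thesis by simp
qed

text \<open>Layer cake formula: insert the integral for \<open>ln (1 + y)\<close> and exchange
  integrals by Tonelli. The tail is kept as a complement because it is the event
  \<open>Y \<omega> \<le> t\<close> that factorises for a maximum of independent variables.\<close>

lemma (in prob_space) nn_integral_ln_1_plus: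
  assumes [measurable]: "Y \<in> borel_measurable M" and "\<And>\<omega>. \<omega> \<in> space M \<Longrightarrow> 0 \<le> Y \<omega>"
  shows "(\<integral>\<^sup>+\<omega>. ennreal (ln (1 + Y \<omega>)) \<partial>M)
    = (\<integral>\<^sup>+t. ennreal ((1 - prob {\<omega> \<in> space M. Y \<omega> \<le> t}) / (1 + t)) * indicator {0<..} t \<partial>lborel)"
proof -
  interpret pair_sigma_finite M lborel ..
  have "(\<integral>\<^sup>+\<omega>. ennreal (ln (1 + Y \<omega>)) \<partial>M)
      = (\<integral>\<^sup>+\<omega>. \<integral>\<^sup>+t. ennreal (1 / (1 + t)) * indicator {0<..} t * (if t < Y \<omega> then 1 else 0) \<partial>lborel \<partial>M)"
    using assms by (intro nn_integral_cong) (auto simp: ennreal_ln_1_plus_eq_nn_integral intro!: nn_integral_cong split: split_indicator)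
  also have "\<dots> = (\<integral>\<^sup>+t. \<integral>\<^sup>+\<omega>. ennreal (1 / (1 + t)) * indicator {0<..} t * (if t < Y \<omega> then 1 else 0) \<partial>M \<partial>lborel)"
    by (rule Fubini'[symmetric]) measurable
  also have "\<dots> = (\<integral>\<^sup>+t. ennreal ((1 - prob {\<omega> \<in> space M. Y \<omega> \<le> t}) / (1 + t)) * indicator {0<..} t \<partial>lborel)"
  proof (rule nn_integral_cong)
    fix t :: real
    have "(\<integral>\<^sup>+\<omega>. (if t < Y \<omega> then 1 else 0) \<partial>M) = (\<integral>\<^sup>+\<omega>. indicator {\<omega> \<in> space M. t < Y \<omega>} \<omega> \<partial>M)"
      by (intro nn_integral_cong) (auto split: split_indicator)
    also have "\<dots> = emeasure M {\<omega> \<in> space M. t < Y \<omega>}" by simp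
    also have "{\<omega> \<in> space M. t < Y \<omega>} = space M - {\<omega> \<in> space M. Y \<omega> \<le> t}" by auto
    also have "emeasure M \<dots> = ennreal (1 - prob {\<omega> \<in> space M. Y \<omega> \<le> t})"
      by (simp add: emeasure_eq_measure prob_compl)
    finally have *: "(\<integral>\<^sup>+\<omega>. (if t < Y \<omega> then 1 else 0) \<partial>M) = ennreal (1 - prob {\<omega> \<in> space M. Y \<omega> \<le> t})" .
    show "(\<integral>\<^sup>+\<omega>. ennreal (1 / (1 + t)) * indicator {0<..} t * (if t < Y \<omega> then 1 else 0) \<partial>M)
      = ennreal ((1 - prob {\<omega> \<in> space M. Y \<omega> \<le> t}) / (1 + t)) * indicator {0<..} t"
      by (subst nn_integral_cmult) (auto simp: * ennreal_mult[symmetric] split: split_indicator)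
  qed
  finally show ?thesis .
qed

text \<open>Continuity of the distribution function excludes atoms, so strict and weak inequalities
  are equally likely.\<close>

lemma (in prob_space) prob_less_eq_cdf:
  fixes g :: "'a \<Rightarrow> real"
  assumes [measurable]: "g \<in> borel_measurable M"
    and cdf: "\<And>x. prob {\<omega> \<in> space M. g \<omega> \<le> x} = F x" and cont: "continuous_on UNIV F"
  shows "prob {\<omega> \<in> space M. g \<omega> < x} = F x" and "(F \<longlongrightarrow> 1) at_top"
proof -
  let ?D = "distr M borel g"
  interpret D: real_distribution ?D by (rule real_distribution_distr) simp
  have cdf_D: "Distribution_Functions.cdf ?D = F"
    by (auto simp: Distribution_Functions.cdf_def fun_eq_iff measure_distr vimage_def Int_def cdf[symmetric] conj_commute)
  show "(F \<longlongrightarrow> 1) at_top" using D.cdf_lim_at_top_prob by (simp add: cdf_D)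
  have "isCont F x" using cont by (simp add: continuous_on_eq_continuous_at)
  then have "measure ?D {x} = 0" using D.isCont_cdf[of x] by (simp add: cdf_D)
  then have 0: "prob {\<omega> \<in> space M. g \<omega> = x} = 0"
    by (simp add: measure_distr vimage_def Int_def conj_commute)
  have "F x = prob ({\<omega> \<in> space M. g \<omega> < x} \<union> {\<omega> \<in> space M. g \<omega> = x})"
    unfolding cdf[symmetric] by (rule arg_cong[where f = prob]) auto
  also have "\<dots> = prob {\<omega> \<in> space M. g \<omega> < x} + prob {\<omega> \<in> space M. g \<omega> = x}"
    by (rule finite_measure_Union) auto
  finally show "prob {\<omega> \<in> space M. g \<omega> < x} = F x" using 0 by simp
qed

lemma Finv_eq:
  assumes mono: "\<And>s t. 0 \<le> s \<Longrightarrow> s < t \<Longrightarrow> F s < F t" and "0 \<le> t"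
  shows "Finv F (F t) = t"
  unfolding Finv_def
proof (rule the_equality)
  fix s assume "0 \<le> s \<and> F s = F t"
  then show "s = t" using mono[of s t] mono[of t s] assms(2) by (cases s t rule: linorder_cases) auto
qed (use assms in auto)

text \<open>For \<open>t \<ge> 0\<close> a truncated value exceeds \<open>t\<close> exactly when
  \<open>g\<close> reaches the threshold and exceeds \<open>t\<close>. The event is therefore the
  larger of two nested ones, \<open>g\<close> below the threshold and \<open>g\<close> at most
  \<open>t\<close>, of probabilities \<open>1 - p\<close> and \<open>F t\<close>.\<close>

lemma (in decaying_density) prob_truncated_le:
  assumes P: "prob_space P" and g [measurable]: "g \<in> borel_measurable P"
    and cdf: "\<And>x. measure P {\<omega> \<in> space P. g \<omega> \<le> x} = F x"
    and p: "p \<in> {0..1}" and t: "0 \<le> t"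
  shows "measure P {\<omega> \<in> space P. truncated (g \<omega>) (threshold F p) \<le> t} = max (F t) (1 - p)"
proof -
  interpret prob_space P by fact
  have trunc: "truncated x \<tau> \<le> t \<longleftrightarrow> ereal x < \<tau> \<or> x \<le> t" for x \<tau>
    using t by (auto simp: truncated_def)
  show ?thesis
  proof (cases "p = 0")
    case True
    then show ?thesis using F_less_1[OF t] by (simp add: trunc threshold_def prob_space)
  next
    case False
    then obtain \<tau> where \<tau>: "0 \<le> \<tau>" "F \<tau> = 1 - p" using F_surj[of "1 - p"] p by auto
    then have thr: "threshold F p = ereal \<tau>"
      using False Finv_eq[of F \<tau>] F_strict_mono by (simp add: threshold_def)
    show ?thesis
    proof (cases "\<tau> \<le> t")
      case True
      then have "{\<omega> \<in> space P. truncated (g \<omega>) (threshold F p) \<le> t} = {\<omega> \<in> space P. g \<omega> \<le> t}"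
        by (auto simp: trunc thr)
      then show ?thesis using True F_mono[of \<tau> t] \<tau> by (simp add: cdf)
    next
      case False
      then have "{\<omega> \<in> space P. truncated (g \<omega>) (threshold F p) \<le> t} = {\<omega> \<in> space P. g \<omega> < \<tau>}"
        by (auto simp: trunc thr)
      \<comment> \<open>A value equal to the threshold is reported, so the event is strict; the
        absence of atoms gives it probability \<open>F \<tau>\<close>.\<close>
      then show ?thesis
        using False F_mono[of t \<tau>] \<tau> t prob_less_eq_cdf(1)[OF g cdf F_cont] by simp
    qed
  qed
qed

lemma Max_truncated_nonneg:
  fixes n :: nat
  assumes "0 < n" "\<And>i. i < n \<Longrightarrow> 0 \<le> g i"
  shows "0 \<le> Max ((\<lambda>i. truncated (g i) (\<tau> i)) ` {..<n})"
proof -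
  have "0 \<le> truncated (g 0) (\<tau> 0)" using assms by (simp add: truncated_def)
  also have "\<dots> \<le> Max ((\<lambda>i. truncated (g i) (\<tau> i)) ` {..<n})" using assms(1) by (intro Max_ge) auto
  finally show ?thesis .
qed

lemma truncated_borel [measurable]: "(\<lambda>x. truncated x \<tau>) \<in> borel_measurable borel"
  unfolding truncated_def by measurable

text \<open>A maximum is at most \<open>t\<close> iff every entry is, and the truncated SINRs are
  independent as images of independent variables. Hence the distribution function of the maximum is
  the product occurring in \<open>beam_rate\<close>.\<close>

lemma (in decaying_density) nn_integral_beam_rate:
  assumes P: "prob_space P" and n: "0 < n"
    and indep: "prob_space.indep_vars P (\<lambda>_. borel) g {..<n}"
    and g [measurable]: "\<And>i. i < n \<Longrightarrow> g i \<in> borel_measurable P"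
    and nonneg: "\<And>i \<omega>. i < n \<Longrightarrow> 0 \<le> g i \<omega>"
    and cdf: "\<And>i x. i < n \<Longrightarrow> measure P {\<omega> \<in> space P. g i \<omega> \<le> x} = F x"
    and p: "\<forall>i<n. p i \<in> {0..1}"
  shows "(\<integral>\<^sup>+\<omega>. ennreal (ln (1 + Max ((\<lambda>i. truncated (g i \<omega>) (threshold F (p i))) ` {..<n}))) \<partial>P) = beam_rate n p"
proof -
  interpret prob_space P by fact
  let ?T = "\<lambda>i \<omega>. truncated (g i \<omega>) (threshold F (p i))"
  let ?Y = "\<lambda>\<omega>. Max ((\<lambda>i. ?T i \<omega>) ` {..<n})"
  have ne: "{..<n} \<noteq> {}" using n by (auto simp: lessThan_empty_iff)
  have T_meas [measurable]: "?T i \<in> borel_measurable P" if "i < n" for i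
    using measurable_compose[OF g[OF that] truncated_borel] .
  have Y_meas: "?Y \<in> borel_measurable P"
    by (rule borel_measurable_Max) auto
  have Y_nonneg: "0 \<le> ?Y \<omega>" for \<omega>
    using n nonneg by (rule Max_truncated_nonneg)
  have T_indep: "indep_vars (\<lambda>_. borel) ?T {..<n}"
    by (rule indep_vars_compose2[OF indep]) simp
  have prob: "prob {\<omega> \<in> space P. ?Y \<omega> \<le> t} = (\<Prod>i<n. max (F t) (1 - p i))" if t: "0 < t" for t
  proof -
    have "{\<omega> \<in> space P. ?Y \<omega> \<le> t} = (\<Inter>i\<in>{..<n}. ?T i -` {..t} \<inter> space P)"
      using n ne by (subst Max_le_iff) auto
    also have "prob \<dots> = (\<Prod>i<n. prob (?T i -` {..t} \<inter> space P))"
      by (rule indep_varsD_finite[OF T_indep ne]) auto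
    also have "\<dots> = (\<Prod>i<n. max (F t) (1 - p i))"
    proof (rule prod.cong)
      fix i assume i: "i \<in> {..<n}"
      have "?T i -` {..t} \<inter> space P = {\<omega> \<in> space P. ?T i \<omega> \<le> t}" by auto
      then show "prob (?T i -` {..t} \<inter> space P) = max (F t) (1 - p i)"
        using prob_truncated_le[OF P g cdf, of i "p i" t] i p t by simp
    qed simp
    finally show ?thesis .
  qed
  show ?thesis
    unfolding nn_integral_ln_1_plus[OF Y_meas Y_nonneg] beam_rate_def
    by (intro nn_integral_cong) (simp add: prob split: split_indicator)
qed

section \<open>Regularity of \<open>F\<close> and \<open>f\<close> from the hypotheses of the
  model\<close>

text \<open>A density describes \<open>F\<close> only through integrals; continuity of
  \<open>f\<close> on the positive axis upgrades this to a pointwise derivative. Positivity of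
  \<open>f\<close> comes last, from monotonicity of the weight combined with the support.\<close>

lemma (in prob_space) decaying_densityI:
  assumes dens: "distributed M lborel g (\<lambda>x. ennreal (f x))"
    and cdf: "\<And>x. prob {\<omega> \<in> space M. g \<omega> \<le> x} = F x"
    and g_nonneg: "\<And>\<omega>. 0 \<le> g \<omega>"
    and F_cont: "continuous_on UNIV F"
    and f_nonneg: "\<And>x. f x \<ge> 0"
    and f_supp: "closure {x. f x \<noteq> 0} = {0..}"
    and f_diff: "f differentiable_on {0<..}"
    and f_cond: "\<forall>x\<in>{0..<1}. \<exists>D. (f has_real_derivative D) (at (Finv F x) within {0..})
                     \<and> D \<le> - f (Finv F x) / (1 + Finv F x)"
  shows "decaying_density F f"
proof -
  have g [measurable]: "g \<in> borel_measurable M"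
    using distributed_measurable[OF dens] by simp
  have F_mono: "F s \<le> F t" if "s \<le> t" for s t
    unfolding cdf[symmetric] using that by (intro finite_measure_mono) auto
  have F_top: "(F \<longlongrightarrow> 1) at_top" by (rule prob_less_eq_cdf(2)[OF g cdf F_cont])
  have "{\<omega> \<in> space M. g \<omega> < 0} = {}" using g_nonneg by (auto simp: not_less)
  then have F_0: "F 0 = 0" using prob_less_eq_cdf(1)[OF g cdf F_cont, of 0] by (metis measure_empty)
  have f_cont_on: "continuous_on {0<..} f" using f_diff by (rule differentiable_imp_continuous_on)
  then have f_cont: "isCont f t" if "0 < t" for t
    using that by (auto simp: continuous_on_eq_continuous_at)
  \<comment> \<open>The base point \<open>c\<close> is positive because continuity of
    \<open>f\<close> is so far available only on the open half-line.\<close>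
  have F_increment: "F x = F c + integral {c..x} f" if c: "0 < c" "c \<le> x" for c x
  proof -
    have cont: "continuous_on {c..x} f" by (rule continuous_on_subset[OF f_cont_on]) (use c in auto)
    have int: "set_integrable lborel {c..x} f"
      by (rule borel_integrable_atLeastAtMost') (rule cont)
    have "{\<omega> \<in> space M. g \<omega> \<le> x} = {\<omega> \<in> space M. g \<omega> \<le> c} \<union> (g -` {c<..x} \<inter> space M)"
      using c by auto
    then have "F x = prob ({\<omega> \<in> space M. g \<omega> \<le> c} \<union> (g -` {c<..x} \<inter> space M))" by (simp flip: cdf)
    also have "\<dots> = F c + prob (g -` {c<..x} \<inter> space M)"
      unfolding cdf[symmetric] by (rule finite_measure_Union) auto
    finally have 1: "F x = F c + prob (g -` {c<..x} \<inter> space M)" .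
    have "emeasure M (g -` {c<..x} \<inter> space M) = (\<integral>\<^sup>+t. ennreal (f t) * indicator {c<..x} t \<partial>lborel)"
      by (rule distributed_emeasure[OF dens]) simp
    also have "\<dots> = (\<integral>\<^sup>+t. ennreal (indicator {c..x} t * f t) \<partial>lborel)"
    proof (rule nn_integral_cong_AE)
      show "AE t in lborel. ennreal (f t) * indicator {c<..x} t = ennreal (indicator {c..x} t * f t)"
        using AE_lborel_singleton[of c] by eventually_elim (auto split: split_indicator)
    qed
    also have "\<dots> = ennreal (LBINT t:{c..x}. f t)"
      unfolding set_lebesgue_integral_def real_scaleR_def
      using int f_nonneg by (intro nn_integral_eq_integral) (auto simp: set_integrable_def)
    also have "(LBINT t:{c..x}. f t) = integral {c..x} f"
      by (rule set_borel_integral_eq_integral(2)[OF int])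
    finally have "prob (g -` {c<..x} \<inter> space M) = integral {c..x} f"
      using integral_nonneg[of f "{c..x}"] f_nonneg integrable_continuous_real[OF cont]
      by (simp add: emeasure_eq_measure)
    then show ?thesis using 1 by simp
  qed
  have F_deriv: "(F has_real_derivative f t) (at t)" if t: "0 < t" for t
  proof -
    have "continuous_on {t / 2..t + 1} f"
      by (rule continuous_on_subset[OF f_cont_on]) (use t in auto)
    then have "((\<lambda>x. integral {t / 2..x} f) has_real_derivative f t) (at t within {t / 2..t + 1})"
      using t by (intro integral_has_real_derivative) auto
    moreover have "at t within {t / 2..t + 1} = at t"
      using t by (intro at_within_interior) auto
    ultimately have "((\<lambda>x. F (t / 2) + integral {t / 2..x} f) has_real_derivative f t) (at t)"
      by (auto intro!: derivative_eq_intros)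
    then show ?thesis
      by (rule has_field_derivative_transform_within_open[where S = "{t / 2<..<t + 1}"])
        (use t in \<open>auto simp: F_increment[symmetric]\<close>)
  qed
  have f_dense: "\<exists>x. s < x \<and> x < t \<and> f x \<noteq> 0" if "0 \<le> s" "s < t" for s t
  proof -
    have "(s + t) / 2 \<in> {s<..<t} \<inter> closure {x. f x \<noteq> 0}" unfolding f_supp using that by auto
    then have "{s<..<t} \<inter> {x. f x \<noteq> 0} \<noteq> {}"
      using open_Int_closure_eq_empty[of "{s<..<t}" "{x. f x \<noteq> 0}"] by (metis empty_iff open_greaterThanLessThan)
    then show ?thesis by auto
  qed
  \<comment> \<open>One point \<open>x\<close> in between with \<open>f x > 0\<close> suffices:
    \<open>F\<close> increases strictly just after \<open>x\<close> and weakly everywhere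
    else.\<close>
  have F_strict: "F s < F t" if st: "0 \<le> s" "s < t" for s t
  proof -
    obtain x where x: "s < x" "x < t" "f x \<noteq> 0" using f_dense[OF st] by blast
    then have "0 < f x" using f_nonneg[of x] by simp
    then obtain d where d: "0 < d" "\<And>h. 0 < h \<Longrightarrow> h < d \<Longrightarrow> F x < F (x + h)"
      using DERIV_pos_inc_right[OF F_deriv, of x] x st by auto
    define h where "h = min (d / 2) (t - x)"
    have "0 < h" "h < d" "x + h \<le> t" using d x by (auto simp: h_def)
    then show ?thesis using d(2)[of h] F_mono[of s x] F_mono[of "x + h" t] x by simp
  qed
  have F_less_1: "F t < 1" if "0 \<le> t" for t
  proof -
    have "F (t + 1) \<le> 1" unfolding cdf[symmetric] by simp
    then show ?thesis using F_strict[of t "t + 1"] that by simp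
  qed
  \<comment> \<open>Instantiated at \<open>F t\<close>, the condition speaks about
    \<open>Finv F (F t) = t\<close>, so it covers every \<open>t \<ge> 0\<close>.\<close>
  have f_deriv: "\<exists>D. (f has_real_derivative D) (at t within {0..}) \<and> D \<le> - f t / (1 + t)" if t: "0 \<le> t" for t
    using f_cond[rule_format, of "F t"] F_less_1[OF t] F_mono[OF t] F_0 Finv_eq[of F t, OF F_strict t] by simp
  have antimono: "(1 + t) * f t \<le> (1 + s) * f s" if st: "0 \<le> s" "s \<le> t" for s t
  proof (rule DERIV_nonpos_imp_decreasing_open[OF st(2)])
    fix x assume x: "s < x" "x < t"
    obtain D where D: "(f has_real_derivative D) (at x within {0..})" "D \<le> - f x / (1 + x)"
      using f_deriv[of x] x st by auto
    have "at x within {0..} = at x" using x st by (intro at_within_interior) auto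
    then have "((\<lambda>x. (1 + x) * f x) has_real_derivative (f x + D * (1 + x))) (at x)"
      using D(1) by (auto intro!: derivative_eq_intros)
    moreover have "f x + D * (1 + x) \<le> 0" using D(2) x st by (simp add: field_simps)
    ultimately show "\<exists>y. ((\<lambda>x. (1 + x) * f x) has_real_derivative y) (at x) \<and> y \<le> 0" by blast
  next
    \<comment> \<open>The one-sided derivative at 0 supplies continuity there, which extends the
      monotonicity to \<open>s = 0\<close>.\<close>
    have "continuous_on {0..} f"
      unfolding continuous_on_eq_continuous_within using f_deriv DERIV_continuous by fastforce
    then have "continuous_on {s..t} f" by (rule continuous_on_subset) (use st in auto)
    then show "continuous_on {s..t} (\<lambda>x. (1 + x) * f x)" by (intro continuous_intros)
  qed
  \<comment> \<open>By \<open>antimono\<close> a zero of \<open>f\<close> would make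
    \<open>f\<close> vanish from there on, against the support.\<close>
  have f_pos: "0 < f t" if t: "0 \<le> t" for t
  proof (rule ccontr)
    assume "\<not> 0 < f t"
    then have "f t = 0" using f_nonneg[of t] by simp
    moreover obtain x where x: "t < x" "f x \<noteq> 0" using f_dense[of t "t + 1"] t by auto
    ultimately have "(1 + x) * f x \<le> 0" using antimono[of t x] t by simp
    moreover have "0 < (1 + x) * f x" using x t f_nonneg[of x] by (simp add: order_less_le)
    ultimately show False by simp
  qed
  show ?thesis
    by unfold_locales (fact F_deriv F_cont F_0 F_top f_cont f_pos antimono)+
qed

section \<open>The sum rate as a multiple of the rate of one beam\<close>

theorem theorem1:
  fixes P :: "'a measure" and n M :: nat and \<rho> :: real
    and X :: "nat \<Rightarrow> nat \<Rightarrow> 'a \<Rightarrow> complex"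
    and F f :: "real \<Rightarrow> real"
  assumes prob: "prob_space P"
    and n: "n \<ge> 2" and M: "M \<ge> 1" and rho: "\<rho> > 0"
    and X_meas: "\<And>i m. i < n \<Longrightarrow> m < M \<Longrightarrow> X i m \<in> borel_measurable P"
    and indep: "prob_space.indep_vars P (\<lambda>_. PiM {..<M} (\<lambda>_. borel))
                  (\<lambda>i \<omega>. \<lambda>m\<in>{..<M}. sinr \<rho> M X i m \<omega>) {..<n}"
    and ident: "\<And>i. i < n \<Longrightarrow>
                  distr P (PiM {..<M} (\<lambda>_. borel)) (\<lambda>\<omega>. \<lambda>m\<in>{..<M}. sinr \<rho> M X i m \<omega>)
                = distr P (PiM {..<M} (\<lambda>_. borel)) (\<lambda>\<omega>. \<lambda>m\<in>{..<M}. sinr \<rho> M X 0 m \<omega>)"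
    and cdf: "\<And>i m x. i < n \<Longrightarrow> m < M \<Longrightarrow>
                  measure P {\<omega> \<in> space P. sinr \<rho> M X i m \<omega> \<le> x} = F x"
    and F_cont: "continuous_on UNIV F"
    and dens: "\<And>i m. i < n \<Longrightarrow> m < M \<Longrightarrow>
                  distributed P lborel (sinr \<rho> M X i m) (\<lambda>x. ennreal (f x))"
    and f_nonneg: "\<And>x. f x \<ge> 0"
    and f_supp: "closure {x. f x \<noteq> 0} = {0..}"
    and f_bdd: "\<exists>e>0. \<exists>B. \<forall>x. \<bar>x\<bar> < e \<longrightarrow> \<bar>f x\<bar> \<le> B"
    and f_diff: "f differentiable_on {0<..}"
    and f_cond: "\<forall>x\<in>{0..<1}. \<exists>D. (f has_real_derivative D) (at (Finv F x) within {0..})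
                     \<and> D \<le> - f (Finv F x) / (1 + Finv F x)"
  shows "schur_concave_on n {p. \<forall>i<n. p i \<in> {0..1}}
           (sum_rate P n M F (sinr \<rho> M X))"
proof -
  have nonneg: "0 \<le> sinr \<rho> M X i m \<omega>" for i m \<omega>
    using rho by (auto simp: sinr_def intro!: divide_nonneg_nonneg add_nonneg_nonneg sum_nonneg)
  have meas: "sinr \<rho> M X i m \<in> borel_measurable P" if "i < n" "m < M" for i m
    using distributed_measurable[OF dens[OF that]] by simp
  interpret prob_space P by fact
  interpret decaying_density F f
    using decaying_densityI[of "sinr \<rho> M X 0 0", OF dens cdf nonneg F_cont f_nonneg f_supp f_diff f_cond] n M
    by simp
  \<comment> \<open>By linearity of expectation the beams contribute separately, whatever their
    dependence within a user, and equal marginal laws make the contributions equal.\<close>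
  have rate: "sum_rate P n M F (sinr \<rho> M X) p = of_nat M * beam_rate n p" if p: "\<forall>i<n. p i \<in> {0..1}" for p
  proof -
    let ?Y = "\<lambda>m \<omega>. Max ((\<lambda>i. truncated (sinr \<rho> M X i m \<omega>) (threshold F (p i))) ` {..<n})"
    have Y_meas: "?Y m \<in> borel_measurable P" if "m < M" for m
      using meas that by (intro borel_measurable_Max) (auto intro: measurable_compose[OF _ truncated_borel])
    have Y_nonneg: "0 \<le> ?Y m \<omega>" for m \<omega>
      using n nonneg by (intro Max_truncated_nonneg) auto
    have "sum_rate P n M F (sinr \<rho> M X) p = (\<integral>\<^sup>+\<omega>. (\<Sum>m<M. ennreal (ln (1 + ?Y m \<omega>))) \<partial>P)"
      unfolding sum_rate_def using Y_nonneg by (simp add: sum_ennreal)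
    also have "\<dots> = (\<Sum>m<M. \<integral>\<^sup>+\<omega>. ennreal (ln (1 + ?Y m \<omega>)) \<partial>P)"
      using Y_meas by (intro nn_integral_sum) simp
    also have "\<dots> = (\<Sum>m<M. beam_rate n p)"
    proof (rule sum.cong)
      fix m assume "m \<in> {..<M}"
      then have m: "m < M" by simp
      \<comment> \<open>Independence is given for whole SINR vectors; projecting to coordinate
        \<open>m\<close> passes it on to a single beam.\<close>
      have "indep_vars (\<lambda>_. borel) (\<lambda>i \<omega>. (\<lambda>m\<in>{..<M}. sinr \<rho> M X i m \<omega>) m) {..<n}"
        by (rule indep_vars_compose2[OF indep]) (use m in \<open>auto intro: measurable_component_singleton\<close>)
      then have "indep_vars (\<lambda>_. borel) (\<lambda>i. sinr \<rho> M X i m) {..<n}" using m by simp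
      then show "(\<integral>\<^sup>+\<omega>. ennreal (ln (1 + ?Y m \<omega>)) \<partial>P) = beam_rate n p"
        using n m meas nonneg cdf p by (intro nn_integral_beam_rate[OF prob]) auto
    qed simp
    finally show ?thesis by simp
  qed
  show ?thesis
    using schur_concave_on_beam_rate[of n]
    by (auto simp: schur_concave_on_def rate intro!: mult_left_mono)
qed

end
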